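(* For any three integers $p\ge 1$, $k\ge 0$, $m\ge 0$, $$\sum_{j=0}^{m}\binom{m}{j}\frac{(-1)^j}{(j+p)^{k+1}}=(p-1)!\sum_{n=0}^{\infty}\begin{bmatrix} n\\ k\end{bmatrix}\frac{1}{n!\,(n+m+1)(n+m+2)\cdots(n+m+p)}.$$
   Context: $\begin{bmatrix} n\\ k\end{bmatrix}$ denotes the unsigned Stirling numbers of the first kind, defined by $x(x+1)\cdots(x+n-1)=\sum_{k=0}^{n}\begin{bmatrix} n\\ k\end{bmatrix}x^k$ (so $\begin{bmatrix} 0\\ 0\end{bmatrix}=1$), with $\begin{bmatrix} n\\ k\end{bmatrix}=0$ for $k>n$. *)

theory Defs
  imports Complex_Main "HOL-Combinatorics.Stirling"
begin

text \<open>
  The unsigned Stirling numbers of the first kind are the library's \<^const>\<open>stirling\<close>, which is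
  defined by recurrence. They have the expected rising-factorial generating polynomial:
\<close>

lemma pochhammer_eq_sum_stirling:
  fixes x :: real
  shows "(\<Prod>i<n. x + real i) = (\<Sum>k\<le>n. real (stirling n k) * x ^ k)"
proof -
  have "(\<Prod>i<n. x + real i) = pochhammer x n"
    by (simp add: pochhammer_prod atLeast0LessThan)
  then show ?thesis
    by (simp add: stirling_pochhammer)
qed

end

theory Submission
  imports Defs "HOL-Analysis.Summation_Tests"
begin

text \<open>
  The sum on the left is the value at \<open>x = p\<close> of the \<open>m\<close>-th iterated difference
  (with the sign of \<open>f x - f (x + 1)\<close>) of \<open>f x = 1 / x ^ (k + 1)\<close>. On the right, the \<open>p\<close>-dependent
  factor of each summand, with \<open>(p - 1)!\<close> included, is the beta value
  \<open>B(p, n + m + 1) = \<integral> t ^ (p - 1) * (1 - t) ^ (n + m) dt\<close> over the unit interval,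
  so raising \<open>m\<close> by one multiplies the integrand by \<open>1 - t\<close>, which again gives the difference
  between the values at \<open>p\<close> and at \<open>p + 1\<close>. Hence both sides satisfy the same recursion in \<open>m\<close>
  (\<open>alternating_binomial_sum_Suc\<close>, \<open>beta_weight_Suc\<close>), and only \<open>m = 0\<close> is left.

  For \<open>m = 0\<close> the claim is the expansion
  \<open>1 / x ^ (k + 1) = (\<Sum>n. stirling n k / (x * (x + 1) * \<dots> * (x + n)))\<close>, valid for every real \<open>x > 0\<close>
  (\<open>stirling_pochhammer_sums\<close>). It goes by induction on \<open>k\<close>: the recurrence of the Stirling numbers
  makes the partial sums for \<open>k\<close> and \<open>x\<close> times those for \<open>k + 1\<close> differ by one boundary
  term, \<open>N\<close> times the \<open>N\<close>-th summand. That boundary term converges, and its limit must be zero,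
  since otherwise the convergent series would dominate a multiple of the harmonic series.
\<close>

lemma summable_imp_nat_mult_limit_zero:
  fixes u :: "nat \<Rightarrow> real"
  assumes "summable u" and nonneg: "\<And>n. u n \<ge> 0" and lim: "(\<lambda>n. real n * u n) \<longlonglongrightarrow> c"
  shows "c = 0"
proof (rule ccontr)
  assume "c \<noteq> 0"
  moreover have "c \<ge> 0"
    using nonneg by (intro LIMSEQ_le_const[OF lim]) auto
  ultimately have "c > 0" by simp
  then have large: "\<forall>\<^sub>F n in sequentially. c / 2 < real n * u n"
    by (intro order_tendstoD(1)[OF lim]) simp
  have "norm (inverse (real n)) \<le> 2 / c * u n" if "c / 2 < real n * u n" "n > 0" for n
    using that \<open>c > 0\<close> by (simp add: divide_simps mult_ac)
  then have "\<forall>\<^sub>F n in sequentially. norm (inverse (real n)) \<le> 2 / c * u n"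
    by (rule eventually_elim2[OF large eventually_gt_at_top[of 0]])
  then have "summable (\<lambda>n. inverse (real n))"
    by (rule summable_comparison_test_ev[OF _ summable_mult[OF \<open>summable u\<close>]])
  then show False
    using not_summable_harmonic[where 'a = real] by contradiction
qed

text \<open>
  Summation by parts: rewrite \<open>stirling n k\<close> as \<open>stirling (n + 1) (k + 1) - n * stirling n (k + 1)\<close>
  and use that two consecutive reciprocals of rising factorials have the ratio \<open>x + n + 1\<close>.
\<close>

lemma stirling_pochhammer_partial_sums:
  fixes x :: real
  assumes "x > 0"
  shows "(\<Sum>n<N. real (stirling n k) / pochhammer x (Suc n)) =
    x * (\<Sum>n<Suc N. real (stirling n (Suc k)) / pochhammer x (Suc n)) +
    real N * (real (stirling N (Suc k)) / pochhammer x (Suc N))"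
proof (induction N)
  case 0
  show ?case by simp
next
  case (Suc N)
  let ?P = "pochhammer x (Suc N)" and ?P' = "pochhammer x (Suc (Suc N))"
  let ?s = "real (stirling (Suc N) (Suc k))"
  have pos: "x + real (Suc N) > 0"
    using assms by linarith
  have "x * (?s / ?P') + real (Suc N) * (?s / ?P') = (x + real (Suc N)) * ?s / ?P'"
    by (simp only: distrib_right add_divide_distrib times_divide_eq_right)
  also have "\<dots> = ?s / ?P"
    using pos by (subst pochhammer_Suc) simp
  also have "\<dots> = real N * (real (stirling N (Suc k)) / ?P) + real (stirling N k) / ?P"
    by (simp add: add_divide_distrib)
  finally show ?case
    using Suc.IH unfolding sum.lessThan_Suc distrib_left by linarith
qed

text \<open>
  With \<open>v = - ln t\<close>, the value \<open>1 / x ^ (k + 1)\<close> is the integral of \<open>t ^ (x - 1) * v ^ k / k!\<close> over the unit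
  interval, and the series comes from expanding \<open>v ^ k / k!\<close> in powers of \<open>1 - t\<close>.
  The partial sums give a proof without integrals: as the boundary
  term is nonnegative, they bound those for \<open>k + 1\<close>, and once that series is known to converge,
  the boundary term has a limit as well.
\<close>

theorem stirling_pochhammer_sums:
  fixes x :: real
  assumes "x > 0"
  shows "(\<lambda>n. real (stirling n k) / pochhammer x (Suc n)) sums (1 / x ^ Suc k)"
proof (induction k)
  case 0
  have "(\<lambda>n. real (stirling n 0) / pochhammer x (Suc n)) sums
      (\<Sum>n\<in>{0}. real (stirling n 0) / pochhammer x (Suc n))"
    by (rule sums_finite) auto
  then show ?case by simp
next
  case (Suc k)
  let ?u = "\<lambda>k n. real (stirling n k) / pochhammer x (Suc n)"
  have nonneg: "?u k n \<ge> 0" for k n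
    using assms by (intro divide_nonneg_nonneg pochhammer_nonneg) auto
  have parts: "sum (?u k) {..<N} = x * sum (?u (Suc k)) {..<Suc N} + real N * ?u (Suc k) N" for N
    using assms by (rule stirling_pochhammer_partial_sums)
  have summable: "summable (?u (Suc k))"
  proof (rule summableI_nonneg_bounded)
    fix N
    have "x * sum (?u (Suc k)) {..<N} \<le> x * sum (?u (Suc k)) {..<Suc N}"
      using assms nonneg[of N "Suc k"] by (intro mult_left_mono) auto
    also have "\<dots> \<le> sum (?u k) {..<N}"
      using mult_nonneg_nonneg[OF of_nat_0_le_iff nonneg[of N "Suc k"], of N] parts[of N] by linarith
    also have "\<dots> \<le> 1 / x ^ Suc k"
      using sum_le_suminf[OF sums_summable[OF Suc.IH], of "{..<N}"] nonneg
        sums_unique[OF Suc.IH] by simp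
    finally show "sum (?u (Suc k)) {..<N} \<le> 1 / x ^ Suc (Suc k)"
      using assms by (simp add: field_simps)
  qed (rule nonneg)
  have "(\<lambda>N. sum (?u k) {..<N} - x * sum (?u (Suc k)) {..<Suc N})
      \<longlonglongrightarrow> 1 / x ^ Suc k - x * suminf (?u (Suc k))"
    using Suc.IH summable_LIMSEQ[OF summable, THEN LIMSEQ_Suc]
    unfolding sums_def by (intro tendsto_intros)
  then have "(\<lambda>N. real N * ?u (Suc k) N) \<longlonglongrightarrow> 1 / x ^ Suc k - x * suminf (?u (Suc k))"
    unfolding parts by simp
  from summable_imp_nat_mult_limit_zero[OF summable nonneg this]
  have "suminf (?u (Suc k)) = 1 / x ^ Suc (Suc k)"
    using assms by (simp add: field_simps)
  then show ?case
    using summable by (simp add: sums_iff)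
qed

text \<open>
  The operator \<open>f \<mapsto> f x - f (x + 1)\<close>, iterated \<open>m\<close> times, has the alternating binomial coefficients
  as weights; Pascal's rule splits off one more application.
\<close>

lemma alternating_binomial_sum_Suc:
  fixes f :: "'a::semiring_1 \<Rightarrow> 'b::comm_ring_1"
  shows "(\<Sum>j\<le>Suc m. of_nat (Suc m choose j) * (-1) ^ j * f (x + of_nat j)) =
    (\<Sum>j\<le>m. of_nat (m choose j) * (-1) ^ j * f (x + of_nat j)) -
    (\<Sum>j\<le>m. of_nat (m choose j) * (-1) ^ j * f (x + 1 + of_nat j))"
proof -
  have pascal: "of_nat (Suc m choose Suc j) * (-1) ^ Suc j * f (x + of_nat (Suc j)) =
      of_nat (m choose Suc j) * (-1) ^ Suc j * f (x + of_nat (Suc j)) -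
      of_nat (m choose j) * (-1) ^ j * f (x + 1 + of_nat j)" for j
    by (simp add: algebra_simps)
  have "(\<Sum>j\<le>m. of_nat (m choose j) * (-1) ^ j * f (x + of_nat j)) =
      (\<Sum>j\<le>Suc m. of_nat (m choose j) * (-1) ^ j * f (x + of_nat j))"
    by (simp add: binomial_eq_0)
  also have "\<dots> = f x +
      (\<Sum>j\<le>m. of_nat (m choose Suc j) * (-1) ^ Suc j * f (x + of_nat (Suc j)))"
    by (subst sum.atMost_Suc_shift) simp
  finally show ?thesis
    by (subst sum.atMost_Suc_shift) (simp only: pascal sum_subtractf, simp)
qed

text \<open>
  For \<open>x > 0\<close> the fraction \<open>fact M / pochhammer x (Suc M)\<close> is the beta value \<open>B(x, M + 1)\<close>,
  and the equation is \<open>B(x, y + 1) = B(x, y) - B(x + 1, y)\<close> at \<open>y = M + 1\<close>.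
\<close>

lemma beta_weight_Suc:
  fixes x :: real
  assumes "x > 0"
  shows "fact (Suc M) / pochhammer x (Suc (Suc M)) =
    fact M / pochhammer x (Suc M) - fact M / pochhammer (x + 1) (Suc M)"
proof -
  let ?P = "pochhammer x (Suc (Suc M))"
  have pos: "?P > 0" "x + real (Suc M) > 0"
    using assms by (auto intro!: pochhammer_pos)
  have "fact M / pochhammer x (Suc M) = fact M * (x + real (Suc M)) / ?P"
    using pos by (subst (2) pochhammer_Suc) simp
  moreover have "fact M / pochhammer (x + 1) (Suc M) = fact M * x / ?P"
    using assms by (subst (2) pochhammer_rec) simp
  ultimately show ?thesis
    by (simp add: algebra_simps flip: diff_divide_distrib add_divide_distrib)
qed

text \<open>
  The shift \<open>x + 1\<close> in the recursion forces \<open>x\<close> to vary in the induction on \<open>m\<close>. Writing the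
  weights as beta values in \<open>x\<close> keeps the number of factors independent of \<open>x\<close>, unlike
  in a product of \<open>p\<close> factors.
\<close>

theorem stirling_beta_sums:
  fixes x :: real
  assumes "x > 0"
  shows "(\<lambda>n. real (stirling n k) / fact n * (fact (n + m) / pochhammer x (Suc (n + m)))) sums
    (\<Sum>j\<le>m. real (m choose j) * (-1) ^ j * (1 / (x + real j) ^ Suc k))"
  using assms
proof (induction m arbitrary: x)
  case 0
  then show ?case
    using stirling_pochhammer_sums[of x k] by simp
next
  case (Suc m)
  have "real (stirling n k) / fact n * (fact (n + m) / pochhammer x (Suc (n + m))) -
      real (stirling n k) / fact n * (fact (n + m) / pochhammer (x + 1) (Suc (n + m))) =
      real (stirling n k) / fact n * (fact (n + Suc m) / pochhammer x (Suc (n + Suc m)))" for n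
    unfolding add_Suc_right beta_weight_Suc[OF Suc.prems] by (simp only: right_diff_distrib)
  moreover have "x + 1 > 0"
    using Suc.prems by simp
  ultimately show ?case
    using sums_diff[OF Suc.IH[OF Suc.prems] Suc.IH[of "x + 1"]]
    unfolding alternating_binomial_sum_Suc[where f = "\<lambda>y. 1 / y ^ Suc k"] by simp
qed

text \<open>Both sides are equal to \<open>(p - 1)! * N! / (N + p)!\<close>.\<close>

lemma beta_weight_of_nat:
  assumes "p \<ge> 1"
  shows "fact (p - 1) / (\<Prod>i=1..p. real (N + i)) = fact N / pochhammer (real p) (Suc N)"
proof -
  obtain q where p: "p = Suc q"
    using assms by (cases p) auto
  have "(\<Prod>i=1..p. real (N + i)) = pochhammer (1 + real N) p"
    by (induction p) (simp_all add: pochhammer_Suc add_ac)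
  then have "fact N * (\<Prod>i=1..p. real (N + i)) = fact (N + p)"
    by (simp only: pochhammer_fact pochhammer_product')
  moreover have "fact q * pochhammer (real p) (Suc N) = fact (q + Suc N)"
    unfolding p pochhammer_fact pochhammer_product' by simp
  ultimately have "fact N * (\<Prod>i=1..p. real (N + i)) = fact (p - 1) * pochhammer (real p) (Suc N)"
    by (simp add: p add.commute)
  moreover have "pochhammer (real p) (Suc N) > 0" "(\<Prod>i=1..p. real (N + i)) > 0"
    using assms by (auto intro!: pochhammer_pos prod_pos)
  ultimately show ?thesis
    by (simp add: frac_eq_eq mult.commute)
qed

theorem proposition8:
  fixes p k m :: nat
  assumes "p \<ge> 1"
  shows "summable (\<lambda>n. real (stirling n k) / (fact n * (\<Prod>i=1..p. real (n + m + i)))) \<and>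
    (\<Sum>j=0..m. real (m choose j) * ((-1) ^ j / real (j + p) ^ (k + 1))) =
      fact (p - 1) * (\<Sum>n. real (stirling n k) / (fact n * (\<Prod>i=1..p. real (n + m + i))))"
proof -
  let ?t = "\<lambda>n. real (stirling n k) / (fact n * (\<Prod>i=1..p. real (n + m + i)))"
  let ?L = "\<Sum>j=0..m. real (m choose j) * ((-1) ^ j / real (j + p) ^ (k + 1))"
  have "fact (p - 1) * ?t n =
      real (stirling n k) / fact n * (fact (n + m) / pochhammer (real p) (Suc (n + m)))" for n
    unfolding beta_weight_of_nat[OF assms, symmetric] by simp
  moreover have "?L = (\<Sum>j\<le>m. real (m choose j) * (-1) ^ j * (1 / (real p + real j) ^ Suc k))"
    by (simp add: atLeast0AtMost add.commute)
  ultimately have "(\<lambda>n. fact (p - 1) * ?t n) sums ?L"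
    using stirling_beta_sums[of "real p" k m] assms by simp
  from sums_mult_D[OF this] show ?thesis
    by (simp add: sums_iff)
qed

end
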